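(* Let $h>0$, let $k\ge 1$ and $1\le T\le k$ be integers, let $\alpha_1,\alpha_2\in\mathbb{R}$, put $\bar\alpha_2=\alpha_2-\alpha_1$, and let $f$ be a real function defined on $[0,kh]$. Suppose the order switches from $\alpha_1$ to $\alpha_2$ at the $T$-th sample, i.e. $\alpha(t)=\alpha_1$ for $t<Th$ and $\alpha(t)=\alpha_1+\bar\alpha_2=\alpha_2$ for $t\ge Th$. Let $y_0,\dots,y_k$ be the output with step $h$ of the simple-switching structure (switching from $\alpha_1$ to $\alpha_2$ at sample $T$) with input $f$; that is, $y_i$ is the step-$h$ approximation of the switched order derivative ${}_0\mathrm{D}^{\alpha(t)}_{ih} f(ih)$. Then $$\begin{pmatrix} y_0\\ y_1\\ \vdots\\ y_k\end{pmatrix}=W(\alpha_1,k)\,W(\bar\alpha_2,k,T)\begin{pmatrix} f(0)\\ f(h)\\ \vdots\\ f(kh)\end{pmatrix},\qquad W(\bar\alpha_2,k,T)=\begin{pmatrix} I_{T,T} & 0_{T,k-T+1}\\ 0_{k-T+1,T} & W(\bar\alpha_2,k-T)\end{pmatrix}.$$ (The switched order derivative itself is the limit of the two sides as $h\to 0$.)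
   Context: For $\alpha\in\mathbb{R}$ and an integer $i\ge 0$, $\binom{\alpha}{i}=\frac{\alpha(\alpha-1)\cdots(\alpha-i+1)}{i!}$ (with $\binom{\alpha}{0}=1$), and for the step $h>0$, $w_{\alpha,i}=\frac{(-1)^i\binom{\alpha}{i}}{h^{\alpha}}$. For an integer $m\ge 0$, $W(\alpha,m)\in\mathbb{R}^{(m+1)\times(m+1)}$ is the lower triangular Toeplitz matrix with rows and columns indexed by $0,\dots,m$, whose $(p,q)$ entry is $w_{\alpha,p-q}$ if $p\ge q$ and $0$ if $p<q$. It represents, at step $h$, the constant order Grunwald-Letnikov derivative ${}_0\mathrm{D}^{\alpha}_t f(t)=\lim_{h\to0}\frac{1}{h^\alpha}\sum_{r=0}^{n}(-1)^r\binom{\alpha}{r}f(t-rh)$, $n=\lfloor t/h\rfloor$. $I_{T,T}$ is the $T\times T$ identity matrix and $0_{p,q}$ the $p\times q$ zero matrix. Simple-switching structure (step $h$): a derivative block of order $\alpha_1$, started at time $0$, acts throughout. Its input is the original signal $f$ before the switching sample $T$; from sample $T$ on, a derivative block of complementary order $\bar\alpha_2$, started at time $Th$, is pre-connected in front of it, so its input is the derivative of order $\bar\alpha_2$ of $f$ with starting time $Th$. At step $h$ this means: the input $g$ of the $\alpha_1$-block is $g_i=f(ih)$ for $0\le i<T$ and $g_i=\sum_{r=0}^{i-T}w_{\bar\alpha_2,r}f((i-r)h)$ for $T\le i\le k$; the output of the structure is $y_i=\sum_{r=0}^{i}w_{\alpha_1,r}\,g_{i-r}$ for $0\le i\le k$.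 *)

theory Defs
  imports Complex_Main "Jordan_Normal_Form.Matrix"
begin

definition gl_weight :: "real \<Rightarrow> real \<Rightarrow> nat \<Rightarrow> real" where
  "gl_weight h \<alpha> i = (- 1) ^ i * (\<alpha> gchoose i) / h powr \<alpha>"

definition gl_matrix :: "real \<Rightarrow> real \<Rightarrow> nat \<Rightarrow> real mat" where
  "gl_matrix h \<alpha> m =
     mat (m + 1) (m + 1) (\<lambda>(p, q). if q \<le> p then gl_weight h \<alpha> (p - q) else 0)"

definition switch_matrix :: "real \<Rightarrow> real \<Rightarrow> nat \<Rightarrow> nat \<Rightarrow> real mat" where
  "switch_matrix h \<beta> k T =
     four_block_mat (1\<^sub>m T) (0\<^sub>m T (k - T + 1))
                    (0\<^sub>m (k - T + 1) T) (gl_matrix h \<beta> (k - T))"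

definition sample_vec :: "real \<Rightarrow> (real \<Rightarrow> real) \<Rightarrow> nat \<Rightarrow> real vec" where
  "sample_vec h f k = vec (k + 1) (\<lambda>i. f (real i * h))"

(* The signal entering the block of order \<alpha>1: from sample T on, a block of order
   \<beta> started at time T * h is connected in front of it. *)
definition preconnected_input ::
    "real \<Rightarrow> real \<Rightarrow> nat \<Rightarrow> (real \<Rightarrow> real) \<Rightarrow> nat \<Rightarrow> real" where
  "preconnected_input h \<beta> T f i =
     (if i < T then f (real i * h)
      else (\<Sum>r = 0..i - T. gl_weight h \<beta> r * f (real (i - r) * h)))"

definition simple_switching_output ::
    "real \<Rightarrow> real \<Rightarrow> real \<Rightarrow> nat \<Rightarrow> (real \<Rightarrow> real) \<Rightarrow> nat \<Rightarrow> real" where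
  "simple_switching_output h \<alpha>1 \<alpha>2 T f i =
     (\<Sum>r = 0..i. gl_weight h \<alpha>1 r * preconnected_input h (\<alpha>2 - \<alpha>1) T f (i - r))"

definition sample_index :: "real \<Rightarrow> real \<Rightarrow> nat" where
  "sample_index h t = nat \<lfloor>t / h\<rfloor>"

definition switches_at :: "(real \<Rightarrow> real) \<Rightarrow> real \<Rightarrow> real \<Rightarrow> real \<Rightarrow> bool" where
  "switches_at \<alpha> \<alpha>1 \<alpha>2 s \<longleftrightarrow> (\<forall>t\<ge>0. \<alpha> t = (if t < s then \<alpha>1 else \<alpha>2))"

(* D is the derivative of f at time t with starting time 0 and switched order \<alpha>: the
   limit, as the step tends to 0 with t and the switching time s kept fixed, of the output
   of the simple-switching structure.  The switching data are determined by \<alpha>, except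
   that s is arbitrary when \<alpha>1 = \<alpha>2; then the pre-connected block has order 0, so it
   is the identity and s does not matter. *)
definition has_switched_derivative ::
    "(real \<Rightarrow> real) \<Rightarrow> (real \<Rightarrow> real) \<Rightarrow> real \<Rightarrow> real \<Rightarrow> bool" where
  "has_switched_derivative \<alpha> f t D \<longleftrightarrow>
     (\<exists>\<alpha>1 \<alpha>2 s. 0 < s \<and> switches_at \<alpha> \<alpha>1 \<alpha>2 s \<and>
        ((\<lambda>h. simple_switching_output h \<alpha>1 \<alpha>2 (sample_index h s) f (sample_index h t))
           \<longlongrightarrow> D) (at_right 0))"

end

theory Submission
  imports Defs
begin

text \<open>The product with the block matrix is computed blockwise: the identity block copies the
  samples taken before the switch, and the Toeplitz block convolves the later samples with the
  weights of the pre-connected block, so the result is the vector of inputs of the outer block.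
  Multiplying by the outer Toeplitz matrix is a discrete convolution, whose entries are the outputs
  of the structure. This identity holds for every step and every switching sample not beyond the
  last one.

  For the limits, the limit in \<^const>\<open>has_switched_derivative\<close> does not depend on the choice
  of \<open>\<alpha>\<^sub>1\<close>, \<open>\<alpha>\<^sub>2\<close> and the switching time: the orders are
  determined as the values of \<open>\<alpha>\<close> at \<open>0\<close> and at late times, and the switching time
  is determined unless the orders agree, in which case the pre-connected block has order \<open>0\<close>
  and is the identity. Applying the identity at each small step, with the sample indices of
  the fixed times, shows that both sides have the same limit.\<close>

lemma gl_matrix_mult_vec:
  "gl_matrix h a m *\<^sub>v vec (m + 1) g = vec (m + 1) (\<lambda>p. \<Sum>r = 0..p. gl_weight h a r * g (p - r))"
proof (rule eq_vecI)
  fix p assume "p < dim_vec (vec (m + 1) (\<lambda>p. \<Sum>r = 0..p. gl_weight h a r * g (p - r)))"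
  then have p: "p < m + 1" by simp
  have "(gl_matrix h a m *\<^sub>v vec (m + 1) g) $ p
          = (\<Sum>q = 0..<m + 1. (if q \<le> p then gl_weight h a (p - q) else 0) * g q)"
    using p by (auto simp: gl_matrix_def scalar_prod_def intro!: sum.cong)
  also have "\<dots> = (\<Sum>q = 0..p. gl_weight h a (p - q) * g q)"
    by (rule sum.mono_neutral_cong_right) (use p in auto)
  also have "\<dots> = (\<Sum>r = 0..p. gl_weight h a r * g (p - r))"
    by (rule sum.reindex_bij_witness[of _ "\<lambda>r. p - r" "\<lambda>r. p - r"]) auto
  finally show "(gl_matrix h a m *\<^sub>v vec (m + 1) g) $ p
      = vec (m + 1) (\<lambda>p. \<Sum>r = 0..p. gl_weight h a r * g (p - r)) $ p"
    using p by simp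
qed (simp add: gl_matrix_def)

lemma switch_matrix_mult_sample_vec:
  assumes "T \<le> k"
  shows "switch_matrix h b k T *\<^sub>v sample_vec h f k = vec (k + 1) (preconnected_input h b T f)"
proof -
  let ?n = "k - T"
  let ?early = "vec T (\<lambda>i. f (real i * h))"
  let ?late = "vec (?n + 1) (\<lambda>i. f (real (T + i) * h))"
  have split: "sample_vec h f k = ?early @\<^sub>v ?late"
    using assms by (intro eq_vecI) (auto simp: sample_vec_def)
  have block: "gl_matrix h b ?n \<in> carrier_mat (?n + 1) (?n + 1)"
    by (simp add: gl_matrix_def)
  have "switch_matrix h b k T *\<^sub>v sample_vec h f k
          = ?early @\<^sub>v (gl_matrix h b ?n *\<^sub>v ?late)"
    unfolding switch_matrix_def split
    by (subst mult_mat_vec_split[OF one_carrier_mat block]) auto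
  also have "\<dots> = ?early @\<^sub>v vec (?n + 1) (\<lambda>p. \<Sum>r = 0..p. gl_weight h b r * f (real (T + (p - r)) * h))"
    by (simp only: gl_matrix_mult_vec)
  also have "\<dots> = vec (k + 1) (preconnected_input h b T f)"
    using assms by (intro eq_vecI) (auto simp: preconnected_input_def intro!: sum.cong)
  finally show ?thesis .
qed

lemma simple_switching_output_matrix:
  assumes "T \<le> k"
  shows "vec (k + 1) (simple_switching_output h a1 a2 T f)
           = gl_matrix h a1 k * switch_matrix h (a2 - a1) k T *\<^sub>v sample_vec h f k"
proof -
  have "gl_matrix h a1 k \<in> carrier_mat (k + 1) (k + 1)"
    by (simp add: gl_matrix_def)
  moreover have "switch_matrix h (a2 - a1) k T \<in> carrier_mat (k + 1) (k + 1)"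
    using assms by (auto simp: switch_matrix_def gl_matrix_def)
  moreover have "sample_vec h f k \<in> carrier_vec (k + 1)"
    by (simp add: sample_vec_def)
  ultimately have "gl_matrix h a1 k * switch_matrix h (a2 - a1) k T *\<^sub>v sample_vec h f k
      = gl_matrix h a1 k *\<^sub>v vec (k + 1) (preconnected_input h (a2 - a1) T f)"
    using switch_matrix_mult_sample_vec[OF assms] by (simp add: assoc_mult_mat_vec)
  also have "\<dots> = vec (k + 1) (simple_switching_output h a1 a2 T f)"
    unfolding gl_matrix_mult_vec by (intro eq_vecI) (simp_all add: simple_switching_output_def)
  finally show ?thesis ..
qed

lemma gl_weight_order_0: "h > 0 \<Longrightarrow> gl_weight h 0 r = (if r = 0 then 1 else 0)"
  by (cases r) (auto simp: gl_weight_def)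

lemma simple_switching_output_equal_orders:
  assumes "h > 0"
  shows "simple_switching_output h a a T f = simple_switching_output h a a T' f"
proof -
  have "preconnected_input h 0 S f i = f (real i * h)" for S i
    using assms by (simp add: preconnected_input_def gl_weight_order_0 if_distrib[of "\<lambda>x. x * _"] cong: if_cong)
  then show ?thesis by (simp add: simple_switching_output_def fun_eq_iff)
qed

lemma switches_at_unique:
  assumes "switches_at \<alpha> a1 a2 s" "switches_at \<alpha> b1 b2 s'" "0 < s" "0 < s'"
  shows "a1 = b1" "a2 = b2" "a1 = a2 \<or> s = s'"
proof -
  have A: "\<alpha> t = (if t < s then a1 else a2)" and B: "\<alpha> t = (if t < s' then b1 else b2)"
    if "t \<ge> 0" for t
    using assms(1,2) that by (auto simp: switches_at_def)
  show first: "a1 = b1" using A[of 0] B[of 0] assms(3,4) by simp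
  show second: "a2 = b2" using A[of "max s s'"] B[of "max s s'"] assms(3,4) by simp
  \<comment> \<open>At the smaller of two distinct switching times exactly one description has switched.\<close>
  show "a1 = a2 \<or> s = s'"
    using A[of "min s s'"] B[of "min s s'"] assms(3,4) first second
    by (cases s s' rule: linorder_cases) auto
qed

text \<open>The existential quantifier over the switching data can be removed: any one description of
  \<open>\<alpha>\<close> with a positive switching time determines the derivative.\<close>

lemma has_switched_derivative_iff:
  assumes "0 < s" and sw: "switches_at \<alpha> a1 a2 s"
  shows "has_switched_derivative \<alpha> f t D \<longleftrightarrow>
    ((\<lambda>h. simple_switching_output h a1 a2 (sample_index h s) f (sample_index h t))
       \<longlongrightarrow> D) (at_right 0)" (is "_ \<longleftrightarrow> (?F a1 a2 s \<longlongrightarrow> D) _")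
proof
  assume "has_switched_derivative \<alpha> f t D"
  then obtain b1 b2 s' where "0 < s'" "switches_at \<alpha> b1 b2 s'"
    and lim: "(?F b1 b2 s' \<longlongrightarrow> D) (at_right 0)"
    by (auto simp: has_switched_derivative_def)
  then have eqs: "a1 = b1" "a2 = b2" "a1 = a2 \<or> s = s'"
    using switches_at_unique[OF sw] assms(1) by blast+
  have "?F b1 b2 s' h = ?F a1 a2 s h" if "h > 0" for h
  proof (cases "a1 = a2")
    case True
    then show ?thesis
      using eqs simple_switching_output_equal_orders[OF that, of a1 "sample_index h s'" f "sample_index h s"]
      by simp
  qed (use eqs in auto)
  then have "\<forall>\<^sub>F h in at_right 0. ?F b1 b2 s' h = ?F a1 a2 s h"
    using eventually_at_right_less[of "0::real"] by (rule eventually_mono[rotated])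
  then show "(?F a1 a2 s \<longlongrightarrow> D) (at_right 0)"
    using lim by (rule Lim_transform_eventually[rotated])
qed (use assms in \<open>auto simp: has_switched_derivative_def\<close>)

lemma sample_index_mono: "0 < h \<Longrightarrow> s \<le> t \<Longrightarrow> sample_index h s \<le> sample_index h t"
  unfolding sample_index_def by (intro nat_mono floor_mono divide_right_mono) auto

theorem lemma1:
  fixes h \<alpha>1 \<alpha>2 \<beta>2 :: real and k T :: nat and f \<alpha> :: "real \<Rightarrow> real"
  assumes "h > 0" and "1 \<le> k" and "1 \<le> T" and "T \<le> k"
    and "\<beta>2 = \<alpha>2 - \<alpha>1"
    and "switches_at \<alpha> \<alpha>1 \<alpha>2 (real T * h)"
  shows "vec (k + 1) (simple_switching_output h \<alpha>1 \<alpha>2 T f)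
           = gl_matrix h \<alpha>1 k * switch_matrix h \<beta>2 k T *\<^sub>v sample_vec h f k
       \<and> (\<forall>i\<le>k. \<forall>D.
            (has_switched_derivative \<alpha> f (real i * h) D \<longleftrightarrow>
               ((\<lambda>\<eta>. vec (sample_index \<eta> (real k * h) + 1)
                       (simple_switching_output \<eta> \<alpha>1 \<alpha>2 (sample_index \<eta> (real T * h)) f)
                     $ sample_index \<eta> (real i * h)) \<longlongrightarrow> D) (at_right 0))
          \<and> (has_switched_derivative \<alpha> f (real i * h) D \<longleftrightarrow>
               ((\<lambda>\<eta>. (gl_matrix \<eta> \<alpha>1 (sample_index \<eta> (real k * h))
                       * switch_matrix \<eta> \<beta>2 (sample_index \<eta> (real k * h))
                           (sample_index \<eta> (real T * h))
                       *\<^sub>v sample_vec \<eta> f (sample_index \<eta> (real k * h)))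
                     $ sample_index \<eta> (real i * h)) \<longlongrightarrow> D) (at_right 0)))"
proof (intro conjI allI impI)
  have \<beta>: "\<beta>2 = \<alpha>2 - \<alpha>1" by (fact assms(5))
  show "vec (k + 1) (simple_switching_output h \<alpha>1 \<alpha>2 T f)
          = gl_matrix h \<alpha>1 k * switch_matrix h \<beta>2 k T *\<^sub>v sample_vec h f k"
    unfolding \<beta> by (rule simple_switching_output_matrix[OF assms(4)])
  fix i D assume i: "i \<le> k"
  let ?K = "\<lambda>\<eta>. sample_index \<eta> (real k * h)"
  let ?S = "\<lambda>\<eta>. sample_index \<eta> (real T * h)"
  let ?i = "\<lambda>\<eta>. sample_index \<eta> (real i * h)"
  let ?y = "\<lambda>\<eta>. vec (?K \<eta> + 1) (simple_switching_output \<eta> \<alpha>1 \<alpha>2 (?S \<eta>) f)"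
  let ?z = "\<lambda>\<eta>. gl_matrix \<eta> \<alpha>1 (?K \<eta>) * switch_matrix \<eta> \<beta>2 (?K \<eta>) (?S \<eta>)
                  *\<^sub>v sample_vec \<eta> f (?K \<eta>)"
  have "0 < real T * h" using assms(1,3) by simp
  note deriv = has_switched_derivative_iff[OF this assms(6)]
  have pos: "\<forall>\<^sub>F \<eta> in at_right (0::real). 0 < \<eta>"
    by (rule eventually_at_right_less)
  \<comment> \<open>The sample index stays within the vector only for positive steps, which suffices for the
    limit from the right.\<close>
  have "?i \<eta> < ?K \<eta> + 1" if "0 < \<eta>" for \<eta>
    using sample_index_mono[OF that, of "real i * h" "real k * h"] i assms(1) by simp
  then have "\<forall>\<^sub>F \<eta> in at_right 0.
      simple_switching_output \<eta> \<alpha>1 \<alpha>2 (?S \<eta>) f (?i \<eta>) = ?y \<eta> $ ?i \<eta>"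
    by (intro eventually_mono[OF pos]) simp
  then show y: "has_switched_derivative \<alpha> f (real i * h) D \<longleftrightarrow>
      ((\<lambda>\<eta>. ?y \<eta> $ ?i \<eta>) \<longlongrightarrow> D) (at_right 0)"
    unfolding deriv by (rule tendsto_cong)
  have "?y \<eta> = ?z \<eta>" if "0 < \<eta>" for \<eta>
    unfolding \<beta> using sample_index_mono[OF that] assms(1,4)
    by (intro simple_switching_output_matrix) simp
  then have "\<forall>\<^sub>F \<eta> in at_right 0. ?y \<eta> $ ?i \<eta> = ?z \<eta> $ ?i \<eta>"
    by (intro eventually_mono[OF pos]) simp
  then show "has_switched_derivative \<alpha> f (real i * h) D \<longleftrightarrow>
      ((\<lambda>\<eta>. ?z \<eta> $ ?i \<eta>) \<longlongrightarrow> D) (at_right 0)"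
    unfolding y by (rule tendsto_cong)
qed

end
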